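(* Fix an integer $v\ge 1$. Then $C_{n,\,1+\pi(n)-v}=v$ for every integer $n>4^{\,v-1}$.
   Context: $p_1=2<p_2=3<\cdots$ are the primes and $\pi(x)$ is the number of primes $\le x$. $K$ is a field containing $\mathbb{Q}$. For a positive integer $n$ put $r=\pi(n)$ and $S=K[x_1,\dots,x_r]$. The weight of a monomial $m=x_1^{a_1}\cdots x_r^{a_r}$ is $w(m)=\prod_i p_i^{a_i}$. $I_n\subset S$ is the monomial ideal generated by all monomials of weight $>n$, and $G(I_n)$ is its minimal monomial generating set. For a monomial $m\ne 1$, $\min(m)$ is the least index $i$ with $a_i>0$. Define $C_{n,u}=\#\{m\in G(I_n):\min(m)=u\}$. *)

theory Defs
  imports
    "HOL-Library.Poly_Mapping"
    "HOL-Library.Infinite_Set"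
    "HOL-Computational_Algebra.Primes"
    "HOL-Algebra.Ideal"
begin

definition prime_pi :: "nat \<Rightarrow> nat" where
  "prime_pi n = card {p::nat. prime p \<and> p \<le> n}"

text \<open>
  The library function \<^const>\<open>enumerate\<close> counts from 0, whereas the primes here
  are numbered from 1; the value at index 0 is irrelevant.
\<close>

definition nth_prime :: "nat \<Rightarrow> nat" where
  "nth_prime i = enumerate {p::nat. prime p} (i - 1)"

text \<open>
  A monomial \<open>x_1 ^ a_1 * ... * x_r ^ a_r\<close> is represented by its finitely supported
  exponent vector, so the monomial \<open>1\<close> is the zero vector. A polynomial is a finitely
  supported map from exponent vectors to coefficients, with convolution as product.
\<close>

definition monomials :: "nat \<Rightarrow> (nat \<Rightarrow>\<^sub>0 nat) set" where
  "monomials r = {m. Poly_Mapping.keys m \<subseteq> {1..r}}"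

definition poly_ring :: "nat \<Rightarrow> ((nat \<Rightarrow>\<^sub>0 nat) \<Rightarrow>\<^sub>0 'k::field) ring" where
  "poly_ring r =
     \<lparr>carrier = {f. Poly_Mapping.keys f \<subseteq> monomials r},
      monoid.mult = (*), one = 1, zero = 0, add = (+)\<rparr>"

definition mpoly_of_monomial :: "(nat \<Rightarrow>\<^sub>0 nat) \<Rightarrow> (nat \<Rightarrow>\<^sub>0 nat) \<Rightarrow>\<^sub>0 'k::field" where
  "mpoly_of_monomial m = Poly_Mapping.single m 1"

lemma cring_poly_ring: "cring (poly_ring r :: ((nat \<Rightarrow>\<^sub>0 nat) \<Rightarrow>\<^sub>0 'k::field) ring)"
proof -
  have add: "Poly_Mapping.keys (f + g) \<subseteq> monomials r"
    if "Poly_Mapping.keys f \<subseteq> monomials r" "Poly_Mapping.keys g \<subseteq> monomials r"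
    for f g :: "(nat \<Rightarrow>\<^sub>0 nat) \<Rightarrow>\<^sub>0 'k"
    using that Poly_Mapping.keys_add[of f g] by blast
  have mult: "Poly_Mapping.keys (f * g) \<subseteq> monomials r"
    if "Poly_Mapping.keys f \<subseteq> monomials r" "Poly_Mapping.keys g \<subseteq> monomials r"
    for f g :: "(nat \<Rightarrow>\<^sub>0 nat) \<Rightarrow>\<^sub>0 'k"
  proof
    fix m assume "m \<in> Poly_Mapping.keys (f * g)"
    then obtain a b where ab: "m = a + b" "a \<in> Poly_Mapping.keys f" "b \<in> Poly_Mapping.keys g"
      using keys_mult[of f g] by blast
    then have "a \<in> monomials r" "b \<in> monomials r" using that by blast+
    then show "m \<in> monomials r"
      using Poly_Mapping.keys_add[of a b] ab(1) by (auto simp: monomials_def)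
  qed
  have one: "Poly_Mapping.keys (1 :: (nat \<Rightarrow>\<^sub>0 nat) \<Rightarrow>\<^sub>0 'k) \<subseteq> monomials r"
    by (auto simp: monomials_def)
  show ?thesis
  proof (rule cringI)
    show "abelian_group (poly_ring r :: ((nat \<Rightarrow>\<^sub>0 nat) \<Rightarrow>\<^sub>0 'k) ring)"
    proof (rule abelian_groupI)
      fix f assume "f \<in> carrier (poly_ring r :: ((nat \<Rightarrow>\<^sub>0 nat) \<Rightarrow>\<^sub>0 'k) ring)"
      then show "\<exists>g\<in>carrier (poly_ring r). g \<oplus>\<^bsub>poly_ring r\<^esub> f = \<zero>\<^bsub>poly_ring r\<^esub>"
        by (intro bexI[of _ "- f"]) (auto simp: poly_ring_def)
    qed (auto simp: poly_ring_def algebra_simps dest: add[THEN subsetD, rotated 2])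
    show "Group.comm_monoid (poly_ring r :: ((nat \<Rightarrow>\<^sub>0 nat) \<Rightarrow>\<^sub>0 'k) ring)"
      by (rule comm_monoidI)
        (use one in \<open>auto simp: poly_ring_def algebra_simps dest: mult[THEN subsetD, rotated 2]\<close>)
  qed (auto simp: poly_ring_def algebra_simps)
qed

definition weight :: "(nat \<Rightarrow>\<^sub>0 nat) \<Rightarrow> nat" where
  "weight m = (\<Prod>i\<in>Poly_Mapping.keys m. nth_prime i ^ Poly_Mapping.lookup m i)"

text \<open>The smallest index of a variable dividing \<open>m\<close>; only meaningful for \<open>m \<noteq> 0\<close>.\<close>

definition min_index :: "(nat \<Rightarrow>\<^sub>0 nat) \<Rightarrow> nat" where
  "min_index m = (LEAST i. Poly_Mapping.lookup m i > 0)"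

definition monomially_generates ::
    "nat \<Rightarrow> (nat \<Rightarrow>\<^sub>0 nat) set \<Rightarrow> ((nat \<Rightarrow>\<^sub>0 nat) \<Rightarrow>\<^sub>0 'k::field) set \<Rightarrow> bool" where
  "monomially_generates r A J \<longleftrightarrow>
     A \<subseteq> monomials r \<and> J = Idl\<^bsub>poly_ring r\<^esub> (mpoly_of_monomial ` A)"

definition min_gens :: "nat \<Rightarrow> ((nat \<Rightarrow>\<^sub>0 nat) \<Rightarrow>\<^sub>0 'k::field) set \<Rightarrow> (nat \<Rightarrow>\<^sub>0 nat) set" where
  "min_gens r J =
     (THE A. monomially_generates r A J \<and> (\<forall>B. B \<subset> A \<longrightarrow> \<not> monomially_generates r B J))"

definition weight_ideal :: "nat \<Rightarrow> ((nat \<Rightarrow>\<^sub>0 nat) \<Rightarrow>\<^sub>0 'k::field) set" where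
  "weight_ideal n =
     Idl\<^bsub>poly_ring (prime_pi n)\<^esub> (mpoly_of_monomial ` {m \<in> monomials (prime_pi n). weight m > n})"

text \<open>The type argument is the coefficient field.\<close>

definition gen_count :: "'k::field itself \<Rightarrow> nat \<Rightarrow> nat \<Rightarrow> nat" where
  "gen_count K n u =
     card {m \<in> min_gens (prime_pi n) (weight_ideal n :: ((nat \<Rightarrow>\<^sub>0 nat) \<Rightarrow>\<^sub>0 'k) set). min_index m = u}"

end

theory Submission
  imports Defs Complex_Main
begin

text \<open>
  The minimal generators are the monomials of weight \<open>> n\<close> that are minimal under divisibility.
  If \<open>p_u ^ 2 > n\<close>, those with least index \<open>u\<close> are exactly \<open>x_u x_j\<close> for \<open>u \<le> j \<le> \<pi>(n)\<close>:
  the cofactor of \<open>x_u\<close> has weight at most \<open>n\<close> and involves only primes \<open>\<ge> p_u\<close>, so it is a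
  single variable. For \<open>u = \<pi>(n) + 1 - v\<close> this gives \<open>v\<close> generators, and \<open>p_u ^ 2 > n\<close> says
  that at least \<open>v\<close> primes lie in \<open>(sqrt n, n]\<close>. It suffices to treat \<open>4 ^ w < n \<le> 4 ^ (w + 1)\<close>
  with \<open>v = w + 1\<close>. There Chebyshev's bound \<open>\<pi>(4 ^ w) \<ge> (4 ^ w - 1) / (2 w)\<close>, which follows from
  \<open>m * (2m choose m)\<close> dividing every common multiple of \<open>1, ..., 2m\<close>, beats the trivial bound
  \<open>\<pi>(2 ^ (w + 1)) \<le> 2 ^ w\<close> once \<open>w \<ge> 4\<close>; for \<open>w \<le> 3\<close> explicit primes are exhibited.
\<close>

section \<open>Divisibility of monomials as addition of exponent vectors\<close>

lemma lookup_pos_decompose: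
  fixes m :: "'a \<Rightarrow>\<^sub>0 nat"
  assumes "Poly_Mapping.lookup m k > 0"
  obtains m' where "m = Poly_Mapping.single k 1 + m'"
proof
  \<comment> \<open>Subtraction is truncated pointwise; the positive exponent at \<open>k\<close>
    makes it exact.\<close>
  show "m = Poly_Mapping.single k 1 + (m - Poly_Mapping.single k 1)"
    using assms by (intro poly_mapping_eqI) (auto simp: lookup_add lookup_minus lookup_single when_def)
qed

lemma nonzero_decompose:
  fixes m :: "'a \<Rightarrow>\<^sub>0 nat"
  assumes "m \<noteq> 0"
  obtains k m' where "m = Poly_Mapping.single k 1 + m'"
proof -
  obtain k where "Poly_Mapping.lookup m k \<noteq> 0"
    using assms by (metis lookup_zero poly_mapping_eqI)
  then have "Poly_Mapping.lookup m k > 0" by simp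
  then obtain m' where "m = Poly_Mapping.single k 1 + m'" by (rule lookup_pos_decompose)
  then show ?thesis by (rule that)
qed

lemma add_eq_0_iff_poly_mapping:
  fixes a b :: "'a \<Rightarrow>\<^sub>0 nat"
  shows "a + b = 0 \<longleftrightarrow> a = 0 \<and> b = 0"
  by (auto simp: poly_mapping_eq_iff lookup_add fun_eq_iff)

text \<open>Natural exponents cannot cancel, so the support of a sum is the union of the supports.
  Hence a cofactor \<open>b\<close> in \<open>m = a + b\<close> lies in \<open>monomials r\<close>
  as soon as \<open>m\<close> does, and later statements can leave \<open>b\<close>
  unrestricted.\<close>

lemma monomials_add_iff: "a + b \<in> monomials r \<longleftrightarrow> a \<in> monomials r \<and> b \<in> monomials r"
proof -
  have "Poly_Mapping.keys (a + b) = Poly_Mapping.keys a \<union> Poly_Mapping.keys b"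
    by (auto simp: in_keys_iff lookup_add)
  then show ?thesis by (auto simp: monomials_def)
qed

lemma monomials_single_iff: "Poly_Mapping.single k (Suc 0) \<in> monomials r \<longleftrightarrow> k \<in> {1..r}"
  by (auto simp: monomials_def)

section \<open>Membership in monomial ideals\<close>

lemma ring_poly_ring: "ring (poly_ring r :: ((nat \<Rightarrow>\<^sub>0 nat) \<Rightarrow>\<^sub>0 'k::field) ring)"
  using cring_poly_ring by (rule cring.axioms)

lemma mpoly_of_monomial_carrier:
  "mpoly_of_monomial m \<in> carrier (poly_ring r) \<longleftrightarrow> m \<in> monomials r"
  by (auto simp: mpoly_of_monomial_def poly_ring_def)

text \<open>The factors are swapped to fit the closure of an ideal under multiplication from the
  left, with \<open>a\<close> the monomial known to be in the ideal.\<close>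

lemma mpoly_of_monomial_add:
  "mpoly_of_monomial (a + b) = mpoly_of_monomial b \<otimes>\<^bsub>poly_ring r\<^esub> mpoly_of_monomial a"
  by (simp add: mpoly_of_monomial_def poly_ring_def mult_single add.commute)

text \<open>Every monomial of \<open>f * g\<close> is a sum of a monomial of \<open>f\<close> and
  one of \<open>g\<close>, so it stays in the up-closed set \<open>U\<close>. This gives upper
  bounds for ideals generated by monomials.\<close>

lemma ideal_of_upset:
  fixes U :: "(nat \<Rightarrow>\<^sub>0 nat) set"
  assumes U: "U \<subseteq> monomials r"
    and up: "\<And>a b. a \<in> U \<Longrightarrow> b \<in> monomials r \<Longrightarrow> a + b \<in> U"
  shows "ideal {f. Poly_Mapping.keys f \<subseteq> U} (poly_ring r :: ((nat \<Rightarrow>\<^sub>0 nat) \<Rightarrow>\<^sub>0 'k::field) ring)"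
    (is "ideal ?I ?R")
proof (rule idealI)
  interpret R: ring ?R by (rule ring_poly_ring)
  show "ring ?R" by (rule ring_poly_ring)
  show "subgroup ?I (add_monoid ?R)"
  proof (rule group.subgroupI[OF R.add.is_group])
    show "?I \<subseteq> carrier (add_monoid ?R)" using U by (auto simp: poly_ring_def)
    have "0 \<in> ?I" by simp
    then show "?I \<noteq> {}" by blast
  next
    fix f assume f: "f \<in> ?I"
    then have "f \<in> carrier ?R" "- f \<in> carrier ?R" using U by (auto simp: poly_ring_def)
    moreover have "f \<oplus>\<^bsub>?R\<^esub> (- f) = \<zero>\<^bsub>?R\<^esub>" by (simp add: poly_ring_def)
    ultimately have "\<ominus>\<^bsub>?R\<^esub> f = - f" using R.minus_equality R.a_comm by metis
    then show "inv\<^bsub>add_monoid ?R\<^esub> f \<in> ?I" using f by (simp add: a_inv_def)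
  next
    fix f g assume "f \<in> ?I" "g \<in> ?I"
    then show "f \<otimes>\<^bsub>add_monoid ?R\<^esub> g \<in> ?I"
      using Poly_Mapping.keys_add[of f g] by (auto simp: poly_ring_def)
  qed
  have "Poly_Mapping.keys (f * g) \<subseteq> U"
    if "f \<in> ?I" "g \<in> carrier ?R" for f g :: "(nat \<Rightarrow>\<^sub>0 nat) \<Rightarrow>\<^sub>0 'k"
    using keys_mult[of f g] that up by (fastforce simp: poly_ring_def)
  then show "g \<otimes>\<^bsub>?R\<^esub> f \<in> ?I" "f \<otimes>\<^bsub>?R\<^esub> g \<in> ?I" if "f \<in> ?I" "g \<in> carrier ?R" for f g
    using that by (simp_all add: poly_ring_def mult.commute)
qed

lemma mpoly_of_monomial_in_Idl_iff:
  fixes r :: nat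
  defines "R \<equiv> poly_ring r :: ((nat \<Rightarrow>\<^sub>0 nat) \<Rightarrow>\<^sub>0 'k::field) ring"
  assumes A: "A \<subseteq> monomials r" and m: "m \<in> monomials r"
  shows "mpoly_of_monomial m \<in> Idl\<^bsub>R\<^esub> (mpoly_of_monomial ` A) \<longleftrightarrow> (\<exists>a\<in>A. \<exists>b. m = a + b)"
proof
  interpret R: ring R unfolding R_def by (rule ring_poly_ring)
  \<comment> \<open>The multiples of elements of \<open>A\<close> form an up-closed set, so the
    polynomials supported there are an ideal containing all generators, hence the generated
    ideal.\<close>
  let ?U = "{c \<in> monomials r. \<exists>a\<in>A. \<exists>b. c = a + b}"
  assume "mpoly_of_monomial m \<in> Idl\<^bsub>R\<^esub> (mpoly_of_monomial ` A)"
  moreover have "ideal {f. Poly_Mapping.keys f \<subseteq> ?U} R" unfolding R_def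
    by (rule ideal_of_upset) (auto simp: monomials_add_iff, metis add.assoc)
  then have "Idl\<^bsub>R\<^esub> (mpoly_of_monomial ` A) \<subseteq> {f. Poly_Mapping.keys f \<subseteq> ?U}"
    using A by (intro R.genideal_minimal) (auto simp: mpoly_of_monomial_def, metis add_0_right)
  ultimately have "mpoly_of_monomial m \<in> {f::(nat \<Rightarrow>\<^sub>0 nat) \<Rightarrow>\<^sub>0 'k. Poly_Mapping.keys f \<subseteq> ?U}" by blast
  then show "\<exists>a\<in>A. \<exists>b. m = a + b" by (auto simp: mpoly_of_monomial_def)
next
  interpret R: ring R unfolding R_def by (rule ring_poly_ring)
  assume "\<exists>a\<in>A. \<exists>b. m = a + b"
  then obtain a b where ab: "a \<in> A" "m = a + b" by blast
  have carr: "mpoly_of_monomial ` A \<subseteq> carrier R"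
    using A by (auto simp: R_def mpoly_of_monomial_carrier)
  interpret I: ideal "Idl\<^bsub>R\<^esub> (mpoly_of_monomial ` A)" R by (rule R.genideal_ideal[OF carr])
  have "mpoly_of_monomial a \<in> Idl\<^bsub>R\<^esub> (mpoly_of_monomial ` A)"
    using R.genideal_self[OF carr] ab by blast
  moreover have "mpoly_of_monomial b \<in> carrier R"
    using m ab by (simp add: R_def mpoly_of_monomial_carrier monomials_add_iff)
  ultimately show "mpoly_of_monomial m \<in> Idl\<^bsub>R\<^esub> (mpoly_of_monomial ` A)"
    using I.I_l_closed unfolding ab(2) R_def mpoly_of_monomial_add[of a b r] by blast
qed

lemma Idl_monomials_subset_iff:
  fixes r :: nat
  defines "R \<equiv> poly_ring r :: ((nat \<Rightarrow>\<^sub>0 nat) \<Rightarrow>\<^sub>0 'k::field) ring"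
  assumes A: "A \<subseteq> monomials r" and B: "B \<subseteq> monomials r"
  shows "Idl\<^bsub>R\<^esub> (mpoly_of_monomial ` A) \<subseteq> Idl\<^bsub>R\<^esub> (mpoly_of_monomial ` B)
    \<longleftrightarrow> (\<forall>a\<in>A. \<exists>b\<in>B. \<exists>c. a = b + c)"
proof -
  interpret R: ring R unfolding R_def by (rule ring_poly_ring)
  have carr: "mpoly_of_monomial ` A \<subseteq> carrier R" "mpoly_of_monomial ` B \<subseteq> carrier R"
    using A B by (auto simp: R_def mpoly_of_monomial_carrier)
  have "(mpoly_of_monomial a \<in> Idl\<^bsub>R\<^esub> (mpoly_of_monomial ` B)) \<longleftrightarrow> (\<exists>b\<in>B. \<exists>c. a = b + c)"
    if "a \<in> A" for a
    unfolding R_def using mpoly_of_monomial_in_Idl_iff[OF B] A that by blast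
  then show ?thesis
    using R.Idl_subset_ideal[OF R.genideal_ideal[OF carr(2)] carr(1)]
    by (simp add: image_subset_iff)
qed

text \<open>Each inclusion between the two ideals is tested on generators, where it is divisibility.
  From here on, generation is a purely combinatorial matter.\<close>

lemma monomially_generates_iff:
  assumes "M \<subseteq> monomials r"
  shows "monomially_generates r A (Idl\<^bsub>poly_ring r\<^esub> (mpoly_of_monomial ` M) :: ((nat \<Rightarrow>\<^sub>0 nat) \<Rightarrow>\<^sub>0 'k::field) set)
    \<longleftrightarrow> A \<subseteq> monomials r \<and> (\<forall>m\<in>M. \<exists>a\<in>A. \<exists>b. m = a + b) \<and> (\<forall>a\<in>A. \<exists>m\<in>M. \<exists>b. a = m + b)"
proof (cases "A \<subseteq> monomials r")
  case True
  then show ?thesis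
    unfolding monomially_generates_def set_eq_subset
    by (simp only: Idl_monomials_subset_iff assms simp_thms)
qed (simp add: monomially_generates_def)

section \<open>Numbering of the primes, and the weight\<close>

lemma prime_nth_prime: "prime (nth_prime i)"
  using enumerate_in_set[OF primes_infinite] by (simp add: nth_prime_def)

lemma nth_prime_mono_iff:
  assumes "1 \<le> i" "1 \<le> j"
  shows "nth_prime i \<le> nth_prime j \<longleftrightarrow> i \<le> j"
  using assms primes_infinite by (auto simp: nth_prime_def)

lemma prime_imp_nth_prime:
  assumes "prime p"
  obtains i where "i \<ge> 1" "nth_prime i = p"
proof -
  obtain k where "enumerate {p::nat. prime p} k = p"
    using enumerate_Ex[of "{p::nat. prime p}" p] assms primes_infinite by auto
  then show ?thesis using that[of "Suc k"] by (simp add: nth_prime_def)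
qed

lemma prime_pi_mono: "m \<le> n \<Longrightarrow> prime_pi m \<le> prime_pi n"
  unfolding prime_pi_def by (rule card_mono) auto

lemma prime_pi_nth_prime:
  assumes "i \<ge> 1"
  shows "prime_pi (nth_prime i) = i"
proof -
  have "{p. prime p \<and> p \<le> nth_prime i} = nth_prime ` {1..i}"
  proof (intro equalityI subsetI)
    fix p assume p: "p \<in> {p. prime p \<and> p \<le> nth_prime i}"
    then obtain j where "j \<ge> 1" "nth_prime j = p" using prime_imp_nth_prime by blast
    then show "p \<in> nth_prime ` {1..i}" using p assms nth_prime_mono_iff[of j i] by auto
  next
    fix p assume "p \<in> nth_prime ` {1..i}"
    then show "p \<in> {p. prime p \<and> p \<le> nth_prime i}"
      using assms by (auto simp: nth_prime_mono_iff prime_nth_prime)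
  qed
  moreover have "inj_on nth_prime {1..i}"
    by (rule inj_onI) (metis atLeastAtMost_iff nth_prime_mono_iff order_antisym order_refl)
  ultimately show ?thesis by (simp add: prime_pi_def card_image)
qed

lemma nth_prime_le_iff:
  assumes "i \<ge> 1"
  shows "nth_prime i \<le> n \<longleftrightarrow> i \<le> prime_pi n"
proof
  show "nth_prime i \<le> n \<Longrightarrow> i \<le> prime_pi n"
    using prime_pi_mono[of "nth_prime i" n] prime_pi_nth_prime[OF assms] by simp
next
  assume i: "i \<le> prime_pi n"
  show "nth_prime i \<le> n"
  proof (rule ccontr)
    assume "\<not> nth_prime i \<le> n"
    then have "{p. prime p \<and> p \<le> n} \<subset> {p. prime p \<and> p \<le> nth_prime i}"
      using prime_nth_prime[of i] by auto
    then have "prime_pi n < prime_pi (nth_prime i)"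
      unfolding prime_pi_def by (rule psubset_card_mono[rotated]) simp
    then show False using i prime_pi_nth_prime[OF assms] by simp
  qed
qed

lemma weight_eq_prod:
  assumes "finite K" "Poly_Mapping.keys m \<subseteq> K"
  shows "weight m = (\<Prod>i\<in>K. nth_prime i ^ Poly_Mapping.lookup m i)"
  unfolding weight_def using assms by (intro prod.mono_neutral_left) (auto simp: in_keys_iff)

lemma weight_add: "weight (a + b) = weight a * weight b"
proof -
  let ?K = "Poly_Mapping.keys a \<union> Poly_Mapping.keys b"
  have "Poly_Mapping.keys (a + b) \<subseteq> ?K" by (rule Poly_Mapping.keys_add)
  then show ?thesis
    by (simp add: weight_eq_prod[of ?K] lookup_add power_add prod.distrib)
qed

lemma weight_single: "weight (Poly_Mapping.single k (Suc 0)) = nth_prime k"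
  by (simp add: weight_def)

lemma weight_zero [simp]: "weight 0 = 1"
  by (simp add: weight_def)

lemma weight_pos: "weight m > 0"
  by (auto simp: weight_def prime_nth_prime prime_gt_0_nat)

lemma weight_gt_1: "m \<noteq> 0 \<Longrightarrow> weight m > 1"
proof -
  assume "m \<noteq> 0"
  then obtain k m' where "m = Poly_Mapping.single k 1 + m'" by (rule nonzero_decompose)
  then have "weight m = nth_prime k * weight m'" by (simp add: weight_add weight_single)
  moreover have "nth_prime k \<ge> 2" using prime_nth_prime prime_ge_2_nat by blast
  ultimately show ?thesis using mult_le_mono[of 2 "nth_prime k" 1 "weight m'"] weight_pos[of m'] by simp
qed

section \<open>The minimal monomial generating set\<close>

text \<open>The divisibility-minimal elements of \<open>M\<close> generate the ideal, by descent on
  the weight, and every monomial generating set contains them. So they form the only irredundant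
  generating set, which makes the definite description in \<open>min_gens\<close>
  meaningful.\<close>

lemma min_gens_Idl:
  assumes M: "M \<subseteq> monomials r"
  shows "min_gens r (Idl\<^bsub>poly_ring r\<^esub> (mpoly_of_monomial ` M) :: ((nat \<Rightarrow>\<^sub>0 nat) \<Rightarrow>\<^sub>0 'k::field) set)
    = {m \<in> M. \<forall>a\<in>M. \<forall>b. m = a + b \<longrightarrow> b = 0}" (is "min_gens r ?J = ?Min")
proof -
  have "\<exists>a\<in>?Min. \<exists>b. m = a + b" if "m \<in> M" for m
    using that
  proof (induction "weight m" arbitrary: m rule: less_induct)
    case (less m)
    show ?case
    proof (cases "m \<in> ?Min")
      case True
      then show ?thesis by (intro bexI[of _ m] exI[of _ 0]) simp_all
    next
      case False
      then obtain a b where ab: "a \<in> M" "m = a + b" "b \<noteq> 0" using less.prems by auto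
      then have "weight a < weight m"
        using weight_gt_1[of b] weight_pos[of a] by (simp add: weight_add)
      then obtain a' c where a': "a' \<in> ?Min" "a = a' + c" using less.hyps[of a] ab(1) by blast
      then have "m = a' + (c + b)" using ab(2) by (simp add: add.assoc)
      then show ?thesis using a'(1) by blast
    qed
  qed
  then have gen: "monomially_generates r ?Min ?J"
    unfolding monomially_generates_iff[OF M]
  proof (intro conjI ballI)
    fix a assume "a \<in> ?Min"
    then show "\<exists>m\<in>M. \<exists>b. a = m + b" by (intro bexI[of _ a] exI[of _ 0]) auto
  qed (use M in auto)
  have sub: "?Min \<subseteq> A" if A: "monomially_generates r A ?J" for A
  proof
    fix m assume m: "m \<in> ?Min"
    then obtain a b where a: "a \<in> A" "m = a + b"
      using A unfolding monomially_generates_iff[OF M] by blast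
    then obtain m' c where c: "m' \<in> M" "a = m' + c"
      using A unfolding monomially_generates_iff[OF M] by blast
    \<comment> \<open>\<open>m\<close> is a multiple of \<open>a\<close>, which is a multiple of
      \<open>m'\<close> in \<open>M\<close>; minimality of \<open>m\<close> collapses the chain to
      \<open>m = a\<close>.\<close>
    then have "m = m' + (c + b)" using a by (simp add: add.assoc)
    then have "c + b = 0" using m c by blast
    then have "b = 0" by (simp add: add_eq_0_iff_poly_mapping)
    then show "m \<in> A" using a by simp
  qed
  show ?thesis unfolding min_gens_def
  proof (rule the_equality)
    show "monomially_generates r ?Min ?J \<and> (\<forall>B. B \<subset> ?Min \<longrightarrow> \<not> monomially_generates r B ?J)"
    proof (intro conjI allI impI notI)
      fix B assume B: "B \<subset> ?Min" "monomially_generates r B ?J"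
      from leD[OF sub[OF B(2)]] B(1) show False by (rule notE)
    qed (rule gen)
    show "A = ?Min" if A: "monomially_generates r A ?J \<and> (\<forall>B. B \<subset> A \<longrightarrow> \<not> monomially_generates r B ?J)" for A
    proof -
      have "?Min \<subseteq> A" by (rule sub[OF conjunct1[OF A]])
      moreover have "\<not> ?Min \<subset> A"
        using gen by (rule contrapos_pn) (rule conjunct2[OF A, rule_format])
      ultimately show ?thesis by (simp add: psubset_eq)
    qed
  qed
qed

section \<open>Generators whose least variable is large\<close>

lemma min_index_le: "Poly_Mapping.lookup m i > 0 \<Longrightarrow> min_index m \<le> i"
  by (simp add: min_index_def Least_le)

lemma lookup_min_index:
  assumes "m \<noteq> 0"
  shows "Poly_Mapping.lookup m (min_index m) > 0"
proof -
  obtain k where "Poly_Mapping.lookup m k > 0"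
    using assms by (metis lookup_zero neq0_conv poly_mapping_eqI)
  then show ?thesis unfolding min_index_def by (rule LeastI)
qed

lemma min_gens_with_large_min_index:
  assumes "n > 0" and u: "1 \<le> u" "u \<le> prime_pi n" and large: "n < nth_prime u ^ 2"
  shows "{m \<in> min_gens (prime_pi n) (weight_ideal n :: ((nat \<Rightarrow>\<^sub>0 nat) \<Rightarrow>\<^sub>0 'k::field) set). min_index m = u}
    = (\<lambda>j. Poly_Mapping.single u 1 + Poly_Mapping.single j 1) ` {u..prime_pi n}"
    (is "?L = ?f ` _")
proof -
  define r where "r = prime_pi n"
  define M where "M = {m \<in> monomials r. weight m > n}"
  have min_gens: "min_gens r (weight_ideal n :: ((nat \<Rightarrow>\<^sub>0 nat) \<Rightarrow>\<^sub>0 'k) set)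
      = {m \<in> M. \<forall>a\<in>M. \<forall>b. m = a + b \<longrightarrow> b = 0}"
    unfolding weight_ideal_def r_def[symmetric] M_def[symmetric]
    by (rule min_gens_Idl) (auto simp: M_def)
  have le_n: "nth_prime j \<le> n" if "j \<in> {u..r}" for j
    using that u by (simp add: nth_prime_le_iff r_def)
  have gt_n: "n < nth_prime i * nth_prime j" if "u \<le> i" "u \<le> j" for i j
  proof -
    have "nth_prime u * nth_prime u \<le> nth_prime i * nth_prime j"
      using that u by (intro mult_le_mono) (simp_all add: nth_prime_mono_iff)
    then show ?thesis using large by (simp add: power2_eq_square)
  qed
  have "?f j \<in> ?L" if j: "j \<in> {u..r}" for j
  proof -
    \<comment> \<open>A proper divisor of \<open>x_u x_j\<close> divides a single variable
      \<open>x_i\<close> with \<open>u \<le> i \<le> r\<close>, whose weight is at most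
      \<open>n\<close>.\<close>
    have "b = 0" if a: "a \<in> M" "?f j = a + b" for a b
    proof (rule ccontr)
      assume "b \<noteq> 0"
      then obtain k b' where b: "b = Poly_Mapping.single k 1 + b'" by (rule nonzero_decompose)
      then have "Poly_Mapping.lookup (?f j) k > 0" using a(2) by (simp add: lookup_add)
      then consider "k = u" | "k = j" by (auto simp: lookup_add lookup_single when_def split: if_splits)
      then obtain i where i: "i \<in> {u..r}"
        and "?f j = Poly_Mapping.single k 1 + Poly_Mapping.single i 1"
      proof cases
        case 1
        then show ?thesis using that[of j] j by simp
      next
        case 2
        then show ?thesis using that[of u] j by (simp add: add.commute)
      qed
      then have "Poly_Mapping.single k 1 + Poly_Mapping.single i 1 = Poly_Mapping.single k 1 + (a + b')"
        using a(2) b by (simp add: ac_simps)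
      then have "nth_prime i = weight a * weight b'"
        by (metis One_nat_def add_left_cancel weight_add weight_single)
      moreover have "weight a \<le> weight a * weight b'"
        using weight_pos[of b'] by simp
      ultimately have "weight a \<le> n" using le_n[OF i] by linarith
      then show False using a(1) by (simp add: M_def)
    qed
    moreover have "?f j \<in> M"
      using j u gt_n[of u j]
      by (auto simp: M_def monomials_add_iff monomials_single_iff weight_add weight_single r_def)
    moreover have "min_index (?f j) = u"
      unfolding min_index_def using j
      by (intro Least_equality) (auto simp: lookup_add lookup_single when_def split: if_splits)
    ultimately show ?thesis by (auto simp: min_gens r_def[symmetric])
  qed
  moreover have "m \<in> ?f ` {u..r}" if m: "m \<in> ?L" for m
  proof -
    have mM: "m \<in> M" and minimal: "\<And>a b. a \<in> M \<Longrightarrow> m = a + b \<Longrightarrow> b = 0" and "min_index m = u"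
      using m by (auto simp: min_gens r_def[symmetric])
    have "m \<noteq> 0" using mM \<open>n > 0\<close> by (auto simp: M_def)
    then obtain m' where m': "m = Poly_Mapping.single u 1 + m'"
      using lookup_min_index \<open>min_index m = u\<close> lookup_pos_decompose by metis
    have m'r: "m' \<in> monomials r" using mM m' by (simp add: M_def monomials_add_iff)
    have "Poly_Mapping.single u (1::nat) \<noteq> 0" by (metis lookup_single_eq lookup_zero one_neq_zero)
    \<comment> \<open>If the cofactor \<open>m'\<close> were in \<open>M\<close>, minimality of
      \<open>m\<close> would force the other factor \<open>x_u\<close> to be trivial.\<close>
    then have "m' \<notin> M" using minimal[of m' "Poly_Mapping.single u 1"] m' by (auto simp: add.commute)
    then have m'n: "weight m' \<le> n" using m'r by (simp add: M_def)
    \<comment> \<open>Otherwise \<open>m = x_u\<close>, whose weight does not exceed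
      \<open>n\<close>.\<close>
    have "m' \<noteq> 0"
      using mM le_n[of u] u by (auto simp: m' M_def weight_single r_def)
    then obtain j m'' where m'': "m' = Poly_Mapping.single j 1 + m''" by (rule nonzero_decompose)
    have ge_u: "u \<le> i" if "Poly_Mapping.lookup m' i > 0" for i
      using min_index_le[of m i] that \<open>min_index m = u\<close> by (simp add: m' lookup_add)
    have "u \<le> j" by (rule ge_u) (simp add: m'' lookup_add)
    \<comment> \<open>A second variable in \<open>m'\<close> would also have index at least
      \<open>u\<close>, and two such primes already multiply to more than \<open>n\<close>.\<close>
    have "m'' = 0"
    proof (rule ccontr)
      assume "m'' \<noteq> 0"
      then obtain k c where c: "m'' = Poly_Mapping.single k 1 + c" by (rule nonzero_decompose)
      have "u \<le> k" by (rule ge_u) (simp add: m'' c lookup_add)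
      have "weight m' = nth_prime j * nth_prime k * weight c"
        by (simp add: m'' c weight_add weight_single)
      moreover have "nth_prime j * nth_prime k * 1 \<le> nth_prime j * nth_prime k * weight c"
        using weight_pos[of c] by (intro mult_le_mono) auto
      ultimately show False using gt_n[OF \<open>u \<le> j\<close> \<open>u \<le> k\<close>] m'n by simp
    qed
    moreover have "j \<in> {1..r}"
      using m'r by (simp add: m'' monomials_add_iff monomials_single_iff)
    ultimately show ?thesis using \<open>u \<le> j\<close> by (simp add: m' m'')
  qed
  ultimately show ?thesis by (auto simp: r_def)
qed

lemma gen_count_large_min_index:
  assumes "n > 0" "1 \<le> u" "u \<le> prime_pi n" "n < nth_prime u ^ 2"
  shows "gen_count TYPE('k::field) n u = Suc (prime_pi n) - u"
proof -
  have "inj (\<lambda>j. Poly_Mapping.single u (1::nat) + Poly_Mapping.single j 1)"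
  proof (rule injI)
    fix i j :: nat
    assume "Poly_Mapping.single u (1::nat) + Poly_Mapping.single i 1
      = Poly_Mapping.single u 1 + Poly_Mapping.single j 1"
    then have "Poly_Mapping.single i (1::nat) = Poly_Mapping.single j 1" by (rule add_left_imp_eq)
    then have "Poly_Mapping.keys (Poly_Mapping.single i (1::nat))
      = Poly_Mapping.keys (Poly_Mapping.single j (1::nat))" by (rule arg_cong)
    then show "i = j" by simp
  qed
  then have "card ((\<lambda>j. Poly_Mapping.single u (1::nat) + Poly_Mapping.single j 1) ` {u..prime_pi n})
      = Suc (prime_pi n) - u"
    by (simp only: card_image[OF inj_on_subset[OF _ subset_UNIV]] card_atLeastAtMost)
  then show ?thesis
    unfolding gen_count_def min_gens_with_large_min_index[OF assms] by simp
qed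

section \<open>Chebyshev-type bounds for the prime-counting function\<close>

text \<open>
  Induction along the Leibniz harmonic triangle:
  \<open>1 / ((k + 1) * (n + 1 choose k + 1)) = 1 / (k * (n choose k)) - 1 / (k * (n + 1 choose k))\<close>.
\<close>

lemma mult_binomial_dvd_common_multiple:
  fixes D :: nat
  assumes "\<forall>j\<in>{1..n}. j dvd D" "1 \<le> k" "k \<le> n"
  shows "k * (n choose k) dvd D"
  using assms
proof (induction n arbitrary: k)
  case 0
  then show ?case by simp
next
  case outer: (Suc n)
  from outer.prems(2,3) show ?case
  proof (induction k rule: nat_induct_at_least)
    case base
    then show ?case using outer.prems(1) by simp
  next
    case (Suc k)
    have kn: "1 \<le> k" "k \<le> n" using Suc.hyps Suc.prems by auto
    have "k * (n choose k) dvd D"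
      using outer.prems(1) kn by (intro outer.IH) auto
    then obtain x where x: "D = k * (n choose k) * x" by blast
    have "k * (Suc n choose k) dvd D" using Suc.IH kn by simp
    then obtain y where y: "D = k * (Suc n choose k) * y" by blast
    have absorb: "(Suc n - k) * (Suc n choose k) = Suc n * (n choose k)"
      using binomial_absorb_comp[of "Suc n" k] by simp
    \<comment> \<open>Subtracting the two multiples of \<open>D\<close> realises the difference in
      the triangle: \<open>D = (n + 1) * (n choose k) * (x - y)\<close>, and
      \<open>(n + 1) * (n choose k) = (k + 1) * (n + 1 choose k + 1)\<close>.\<close>
    have "Suc n * (n choose k) * x * k = Suc n * D"
      by (simp add: x algebra_simps)
    moreover have "Suc n * (n choose k) * y * k = (Suc n - k) * D"
      unfolding absorb[symmetric] by (simp add: y)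
    moreover have "Suc n * D = (Suc n - k) * D + k * D"
      using kn by (simp flip: add_mult_distrib)
    ultimately have "Suc n * (n choose k) * (x - y) * k = D * k"
      by (simp add: diff_mult_distrib diff_mult_distrib2)
    then have "D = Suc n * (n choose k) * (x - y)" using kn by simp
    then show ?case
      by (metis Suc_times_binomial dvd_triv_left)
  qed
qed

text \<open>The witness is the least common multiple of \<open>1, ..., n\<close>. Each prime enters
  with the largest exponent seen in some \<open>j \<le> n\<close>, so its power divides that
  \<open>j\<close> and is at most \<open>n\<close>; there are \<open>prime_pi n\<close> such
  factors.\<close>

lemma common_multiple_exists:
  fixes n :: nat
  obtains D :: nat where "D > 0" "D \<le> n ^ prime_pi n" "\<forall>j\<in>{1..n}. j dvd D"
proof (cases "n = 0")
  case True
  then have "{p. prime p \<and> p \<le> n} = {}" by (auto intro: ccontr)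
  then have "prime_pi n = 0" by (simp only: prime_pi_def card.empty)
  then show ?thesis using that[of 1] True by simp
next
  case n: False
  define P where "P = {p::nat. prime p \<and> p \<le> n}"
  \<comment> \<open>The maximum needs a nonempty range, hence the separate case
    \<open>n = 0\<close>.\<close>
  define e where "e p = Max (multiplicity p ` {1..n})" for p
  define D where "D = (\<Prod>p\<in>P. p ^ e p)"
  have "finite P" by (auto simp: P_def)
  have le: "p ^ e p \<le> n" for p
  proof -
    have "e p \<in> multiplicity p ` {1..n}" unfolding e_def using n by (intro Max_in) auto
    then obtain j where j: "j \<in> {1..n}" "e p = multiplicity p j" by blast
    then have "p ^ e p dvd j" by (simp add: multiplicity_dvd)
    then show ?thesis using j dvd_imp_le[of "p ^ e p" j] by auto
  qed
  show ?thesis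
  proof (rule that)
    show "D > 0" by (auto simp: D_def P_def prime_gt_0_nat)
    have "D \<le> (\<Prod>p\<in>P. n)" unfolding D_def by (rule prod_mono) (use le in auto)
    then show "D \<le> n ^ prime_pi n" by (simp add: prime_pi_def P_def)
    have "j dvd D" if j: "j \<in> {1..n}" for j
    proof -
      have "j = (\<Prod>p\<in>prime_factors j. p ^ multiplicity p j)"
        using j prime_factorization_nat by auto
      also have "\<dots> = (\<Prod>p\<in>P. p ^ multiplicity p j)"
      proof (rule prod.mono_neutral_left)
        show "prime_factors j \<subseteq> P"
          using j by (auto simp: P_def in_prime_factors_iff dest!: dvd_imp_le)
        show "\<forall>p\<in>P - prime_factors j. p ^ multiplicity p j = 1"
          using j by (auto simp: P_def in_prime_factors_iff not_dvd_imp_multiplicity_0)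
      qed fact
      also have "\<dots> dvd D" unfolding D_def
        using j by (intro prod_dvd_prod le_imp_power_dvd) (auto simp: e_def)
      finally show "j dvd D" .
    qed
    then show "\<forall>j\<in>{1..n}. j dvd D" by blast
  qed
qed

text \<open>The factor \<open>m\<close> in \<open>m * (2 * m choose m)\<close> absorbs the loss of
  \<open>2 * m\<close> in the lower bound for the central binomial coefficient, leaving only the
  constant 2.\<close>

lemma four_power_le_prime_pi_bound:
  assumes "m > 0"
  shows "4 ^ m \<le> 2 * (2 * m) ^ prime_pi (2 * m)"
proof -
  obtain D where D: "D > 0" "D \<le> (2 * m) ^ prime_pi (2 * m)"
    "\<forall>j\<in>{1..2 * m}. j dvd D"
    by (rule common_multiple_exists[of "2 * m"])
  have "m * (2 * m choose m) dvd D"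
    using D(3) assms by (intro mult_binomial_dvd_common_multiple) auto
  then have "m * (2 * m choose m) \<le> D" using D(1) by (rule dvd_imp_le)
  moreover have "4 ^ m \<le> 2 * (m * (2 * m choose m))"
  proof -
    have "4 ^ m / (2 * real m) \<le> real (2 * m choose m)"
      using assms by (rule central_binomial_lower_bound)
    then have "4 ^ m \<le> 2 * (real m * real (2 * m choose m))"
      using assms by (simp add: field_simps)
    then have "real (4 ^ m) \<le> real (2 * (m * (2 * m choose m)))" by simp
    then show ?thesis by (simp only: of_nat_le_iff)
  qed
  ultimately show ?thesis using D(2) by linarith
qed

lemma prime_pi_four_power:
  assumes "w \<ge> 1"
  shows "4 ^ w \<le> 2 * w * prime_pi (4 ^ w) + 1"
proof -
  \<comment> \<open>Half of \<open>4 ^ w\<close>. Then both sides of the previous bound are powers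
    of 2, and exponents can be compared.\<close>
  define m :: nat where "m = 2 * 4 ^ (w - 1)"
  have m: "m > 0" "2 * m = 4 ^ w" using assms by (auto simp: m_def simp flip: power_Suc)
  have "(2::nat) ^ (4 ^ w) = 4 ^ m" using m(2) by (simp add: power_mult flip: m(2))
  also have "\<dots> \<le> 2 * (4 ^ w) ^ prime_pi (4 ^ w)"
    using four_power_le_prime_pi_bound[OF m(1)] m(2) by simp
  also have "\<dots> = 2 ^ (2 * w * prime_pi (4 ^ w) + 1)"
    by (simp add: power_mult)
  finally show ?thesis by (rule power_le_imp_le_exp[rotated]) simp
qed

text \<open>Halving sends an odd prime \<open>2 * k + 1\<close> to \<open>k \<ge> 1\<close>, while 2
  takes the slot 0 left free because 1 is not prime.\<close>

lemma prime_pi_double_le: "prime_pi (2 * t) \<le> t"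
proof -
  let ?P = "{p::nat. prime p \<and> p \<le> 2 * t}"
  have "inj_on (\<lambda>p. (p - 1) div 2) ?P"
  proof (rule inj_onI)
    fix p q assume pq: "p \<in> ?P" "q \<in> ?P" "(p - 1) div 2 = (q - 1) div 2"
    have "p = 2 \<or> odd p" "q = 2 \<or> odd q"
      using pq primes_dvd_imp_eq[OF two_is_prime_nat] by blast+
    moreover have "p \<ge> 2" "q \<ge> 2" using pq prime_ge_2_nat by auto
    ultimately show "p = q" using pq(3) by (auto elim!: oddE)
  qed
  moreover have "(\<lambda>p. (p - 1) div 2) ` ?P \<subseteq> {..<t}"
    by (auto dest: prime_gt_0_nat)
  ultimately have "card ?P \<le> card {..<t}" by (intro card_inj_on_le) auto
  then show ?thesis by (simp add: prime_pi_def)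
qed

section \<open>Primes above the square root of \<open>n\<close>, and the conclusion\<close>

lemma card_primes_above_sqrt:
  assumes "4 ^ w < n" "n \<le> 4 ^ Suc w"
  shows "Suc w \<le> card {p::nat. prime p \<and> p \<le> n \<and> n < p ^ 2}"
proof -
  define Q where "Q = {p::nat. prime p \<and> p \<le> n \<and> n < p ^ 2}"
  have fin: "finite Q" by (auto simp: Q_def)
  have witness: "card X \<le> card Q" if "X \<subseteq> Q" for X
    using that fin by (simp add: card_mono)
  consider "w = 0" | "w = 1" | "w = 2" | "w = 3" | "w \<ge> 4" by linarith
  then have "Suc w \<le> card Q"
  proof cases
    case 1
    \<comment> \<open>Here \<open>n\<close> is 2, 3 or 4; at 4 the prime 2 fails since its square no
      longer exceeds \<open>n\<close>.\<close>
    then show ?thesis using witness[of "{if n \<le> 3 then 2 else 3}"] assms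
      by (auto simp: Q_def)
  next
    case 2
    \<comment> \<open>Here \<open>5 \<le> n \<le> 16\<close>; 3 serves while \<open>n < 9\<close>,
      and 7 is available afterwards.\<close>
    then show ?thesis using witness[of "{5, if n \<le> 8 then 3 else 7}"] assms
      by (auto simp: Q_def)
  next
    case 3
    \<comment> \<open>For \<open>17 \<le> n \<le> 64\<close>, fixed primes from 8 < p \<le> 17
      suffice.\<close>
    then show ?thesis using witness[of "{11, 13, 17}"] assms
      by (auto simp: Q_def)
  next
    case 4
    \<comment> \<open>For \<open>65 \<le> n \<le> 256\<close>, fixed primes from 16 < p \<le> 65
      suffice.\<close>
    then show ?thesis using witness[of "{17, 19, 23, 29}"] assms
      by (auto simp: Q_def)
  next
    case w: 5
    \<comment> \<open>A prime up to \<open>n\<close> outside \<open>Q\<close> is at most the square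
      root of \<open>4 ^ Suc w\<close>.\<close>
    have "{p. prime p \<and> p \<le> n} \<subseteq> Q \<union> {p. prime p \<and> p \<le> 2 * 2 ^ w}"
    proof -
      have "p \<le> 2 * 2 ^ w" if "p ^ 2 \<le> n" for p :: nat
      proof -
        have "(4::nat) ^ Suc w = (2 * 2 ^ w) ^ 2"
          by (simp add: power_mult_distrib power2_eq_square flip: power_mult_distrib)
        then show ?thesis using that assms(2) power2_nat_le_imp_le power_mono_iff
          by (metis le_trans power2_le_imp_le zero_le)
      qed
      then have "p \<le> 2 * 2 ^ w \<or> n < p ^ 2" for p :: nat by (meson not_le)
      then show ?thesis unfolding Q_def by blast
    qed
    then have "prime_pi n \<le> card (Q \<union> {p. prime p \<and> p \<le> 2 * 2 ^ w})"
      unfolding prime_pi_def by (rule card_mono[rotated]) (simp add: fin)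
    also have "\<dots> \<le> card Q + prime_pi (2 * 2 ^ w)"
      unfolding prime_pi_def by (rule card_Un_le)
    finally have "prime_pi n \<le> card Q + 2 ^ w" using prime_pi_double_le[of "2 ^ w"] by linarith
    moreover have "prime_pi (4 ^ w) \<le> prime_pi n" using assms by (intro prime_pi_mono) simp
    ultimately have "2 * w * prime_pi (4 ^ w) \<le> 2 * w * (card Q + 2 ^ w)" by (intro mult_le_mono) auto
    then have upper: "4 ^ w \<le> 2 * w * (card Q + 2 ^ w) + 1"
      using prime_pi_four_power[of w] w by linarith
    \<comment> \<open>This is where \<open>w \<ge> 4\<close> enters; equality holds at 4.\<close>
    have X: "4 * w \<le> 2 ^ w" using w by (induction w rule: nat_induct_at_least) auto
    show ?thesis
    proof (rule ccontr)
      assume "\<not> Suc w \<le> card Q"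
      then have "2 * w * (card Q + 2 ^ w) \<le> 2 * w * (w + 2 ^ w)" by (intro mult_le_mono) auto
      \<comment> \<open>The left side is \<open>(4 * w)^2 + 4 * (4 * w) * 2 ^ w\<close>, at most
        five times \<open>4 ^ w\<close>. With \<open>upper\<close> this would give
        \<open>3 * 4 ^ w \<le> 8\<close>.\<close>
      moreover have "8 * (2 * w * (w + 2 ^ w)) \<le> 5 * 4 ^ w"
      proof -
        have "(4 * w) * (4 * w) \<le> 2 ^ w * 2 ^ w" "(4 * w) * 2 ^ w \<le> 2 ^ w * 2 ^ w"
          using X by (intro mult_le_mono; simp)+
        moreover have "(2::nat) ^ w * 2 ^ w = 4 ^ w" by (simp flip: power_mult_distrib)
        ultimately show ?thesis by (simp add: algebra_simps)
      qed
      moreover have "(256::nat) \<le> 4 ^ w" using power_increasing[OF w, of "4::nat"] by simp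
      ultimately show False using upper by linarith
    qed
  qed
  then show ?thesis by (simp add: Q_def)
qed

text \<open>Every \<open>n \<ge> 2\<close> lies in some interval
  \<open>4 ^ w < n \<le> 4 ^ (w + 1)\<close>, and the hypothesis forces
  \<open>v \<le> w + 1\<close>.\<close>

lemma card_primes_above_sqrt_ge:
  assumes "v \<ge> 1" "4 ^ (v - 1) < n"
  shows "v \<le> card {p::nat. prime p \<and> p \<le> n \<and> n < p ^ 2}"
proof -
  have "(1::nat) \<le> 4 ^ (v - 1)" by simp
  then have "2 \<le> n" using assms(2) by linarith
  then obtain w where w: "4 ^ w < n" "n \<le> 4 ^ Suc w"
    using ex_power_ivl2[of 4 n] by auto
  then have "(4::nat) ^ (v - 1) < 4 ^ Suc w" using assms(2) by linarith
  then have "v - 1 < Suc w" by (rule power_less_imp_less_exp[rotated]) simp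
  then show ?thesis using card_primes_above_sqrt[OF w] by linarith
qed

theorem proposition10:
  fixes n v :: nat
  assumes "v \<ge> 1"
    and "n > 4 ^ (v - 1)"
  shows "gen_count TYPE('k::field_char_0) n (1 + prime_pi n - v) = v"
proof -
  define Q where "Q = {p::nat. prime p \<and> p \<le> n \<and> n < p ^ 2}"
  define u where "u = 1 + prime_pi n - v"
  have v: "v \<le> card Q" unfolding Q_def using assms by (rule card_primes_above_sqrt_ge)
  also have "card Q \<le> prime_pi n" unfolding prime_pi_def Q_def by (rule card_mono) auto
  \<comment> \<open>Since \<open>v \<le> prime_pi n\<close>, the truncated subtraction in
    \<open>u\<close> is exact.\<close>
  finally have u: "1 \<le> u" "u \<le> prime_pi n" using assms(1) by (auto simp: u_def)
  have "n < nth_prime u ^ 2"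
  proof (rule ccontr)
    assume small: "\<not> n < nth_prime u ^ 2"
    \<comment> \<open>If \<open>p_u ^ 2 \<le> n\<close>, all elements of \<open>Q\<close> have index
      above \<open>u\<close>, but only \<open>v - 1\<close> indices remain up to
      \<open>prime_pi n\<close>.\<close>
    have "Q \<subseteq> nth_prime ` {Suc u..prime_pi n}"
    proof
      fix p assume p: "p \<in> Q"
      then obtain i where i: "i \<ge> 1" "nth_prime i = p" using prime_imp_nth_prime by (auto simp: Q_def)
      have "i \<le> prime_pi n" using p i nth_prime_le_iff[of i n] by (auto simp: Q_def)
      moreover have "\<not> i \<le> u"
      proof
        assume "i \<le> u"
        then have "p \<le> nth_prime u" using i u nth_prime_mono_iff[of i u] by simp
        then have "p ^ 2 \<le> nth_prime u ^ 2" by (intro power_mono) auto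
        then have "p ^ 2 \<le> n" using small by linarith
        then show False using p by (auto simp: Q_def)
      qed
      ultimately show "p \<in> nth_prime ` {Suc u..prime_pi n}" using i by auto
    qed
    then have "card Q \<le> card {Suc u..prime_pi n}" by (rule surj_card_le[rotated]) simp
    then show False using v assms(1) u by (simp add: u_def)
  qed
  then have "gen_count TYPE('k) n u = Suc (prime_pi n) - u"
    using assms u by (intro gen_count_large_min_index) auto
  then show ?thesis using u by (simp add: u_def)
qed

end
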